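(* Let $m\in\mathbb N=\{1,2,\dots\}$ and let $M(x,y,z)=x^4y^2+x^2y^4+z^6-3x^2y^2z^2$ be the Motzkin form. Then $M^m$ is a SONC form, i.e. $M^m\in C_{3,6m}$, if and only if $m=1$.
   Context: $H_{n,k}$ is the real vector space of forms of degree $k$ in $n$ variables. For $f=\sum_\alpha f_\alpha x^\alpha\in H_{n,2d}$: $\operatorname{supp}(f)=\{\alpha\in\mathbb N_0^n:f_\alpha\neq0\}$, $\operatorname{New}(f)=\operatorname{conv}(\operatorname{supp}(f))$, $V(f)$ is the vertex set of $\operatorname{New}(f)$, $\mathcal S(f)=\{\alpha\in\operatorname{supp}(f):\alpha\in(2\mathbb N_0)^n,\ f_\alpha>0\}$, $\mathcal I(f)=\operatorname{supp}(f)\setminus\mathcal S(f)$. A form $f\in H_{n,2d}$ is a circuit if $\mathcal S(f)=V(f)$, $V(f)$ is affinely independent (single points and the empty set count as affinely independent), and either $\mathcal I(f)=\emptyset$ or $\mathcal I(f)=\{\beta\}$ with $\beta$ in the relative interior of $\operatorname{New}(f)$. It is a nonnegative circuit if moreover $f\ge0$ on $\mathbb R^n$. $C_{n,2d}$ is the set of all finite sums of nonnegative circuits in $H_{n,2d}$; its elements are called SONC forms. *)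

theory Defs
  imports "HOL-Analysis.Analysis" "HOL-Library.Poly_Mapping"
begin

text \<open>
  Real polynomials in the variables indexed by a finite type \<open>'n\<close>: finitely supported maps from
  exponent vectors to coefficients, whose ring structure (convolution) comes from
  \<^theory>\<open>HOL-Library.Poly_Mapping\<close>. The support of \<open>f\<close> is \<^term>\<open>Poly_Mapping.keys f\<close>.
\<close>

type_synonym 'n mpoly = "(nat ^ 'n) \<Rightarrow>\<^sub>0 real"

definition eval_mpoly :: "'n::finite mpoly \<Rightarrow> real ^ 'n \<Rightarrow> real" where
  "eval_mpoly f x =
     (\<Sum>\<alpha>\<in>Poly_Mapping.keys f. Poly_Mapping.lookup f \<alpha> * (\<Prod>i\<in>UNIV. x $ i ^ (\<alpha> $ i)))"

text \<open>The space $H_{n,k}$; it contains the zero polynomial.\<close>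

definition forms :: "nat \<Rightarrow> 'n::finite mpoly set" where
  "forms k = {f. \<forall>\<alpha>\<in>Poly_Mapping.keys f. (\<Sum>i\<in>UNIV. \<alpha> $ i) = k}"

definition real_exponent :: "nat ^ 'n \<Rightarrow> real ^ 'n::finite" where
  "real_exponent \<alpha> = (\<chi> i. real (\<alpha> $ i))"

definition newton_polytope :: "'n::finite mpoly \<Rightarrow> (real ^ 'n) set" where
  "newton_polytope f = convex hull (real_exponent ` Poly_Mapping.keys f)"

definition newton_vertices :: "'n::finite mpoly \<Rightarrow> (real ^ 'n) set" where
  "newton_vertices f = {v. v extreme_point_of newton_polytope f}"

definition square_support :: "'n::finite mpoly \<Rightarrow> (nat ^ 'n) set" where
  "square_support f =
     {\<alpha> \<in> Poly_Mapping.keys f. (\<forall>i. even (\<alpha> $ i)) \<and> Poly_Mapping.lookup f \<alpha> > 0}"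

definition inner_support :: "'n::finite mpoly \<Rightarrow> (nat ^ 'n) set" where
  "inner_support f = Poly_Mapping.keys f - square_support f"

definition circuit :: "'n::finite mpoly \<Rightarrow> bool" where
  "circuit f \<longleftrightarrow>
     real_exponent ` square_support f = newton_vertices f \<and>
     \<not> affine_dependent (newton_vertices f) \<and>
     (inner_support f = {} \<or>
      (\<exists>\<beta>. inner_support f = {\<beta>} \<and> real_exponent \<beta> \<in> rel_interior (newton_polytope f)))"

definition nonneg_circuit :: "'n::finite mpoly \<Rightarrow> bool" where
  "nonneg_circuit f \<longleftrightarrow> circuit f \<and> (\<forall>x. eval_mpoly f x \<ge> 0)"

text \<open>
  The set $C_{n,k}$ of SONC forms of degree $k = 2d$. For odd \<open>k\<close>, which is not a case of
  interest, the only circuit of degree \<open>k\<close> is \<open>0\<close>, as the vertices of a circuit are even.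
\<close>

definition sonc_forms :: "nat \<Rightarrow> 'n::finite mpoly set" where
  "sonc_forms k = {sum_list fs | fs. \<forall>f\<in>set fs. f \<in> forms k \<and> nonneg_circuit f}"

definition motzkin :: "3 mpoly" where
  "motzkin =
     Poly_Mapping.single (vector [4, 2, 0]) 1 + Poly_Mapping.single (vector [2, 4, 0]) 1
     + Poly_Mapping.single (vector [0, 0, 6]) 1 - Poly_Mapping.single (vector [2, 2, 2]) 3"

lemma eval_motzkin:
  "eval_mpoly motzkin (vector [x, y, z])
     = x^4 * y^2 + x^2 * y^4 + z^6 - 3 * x^2 * y^2 * z^2"
proof -
  define a b c d :: "nat ^ 3"
    where "a = vector [4, 2, 0]" and "b = vector [2, 4, 0]"
      and "c = vector [0, 0, 6]" and "d = vector [2, 2, 2]"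
  note defs = a_def b_def c_def d_def
  have comps: "a $ 1 = 4" "a $ 2 = 2" "a $ 3 = 0" "b $ 1 = 2" "b $ 2 = 4" "b $ 3 = 0"
    "c $ 1 = 0" "c $ 2 = 0" "c $ 3 = 6" "d $ 1 = 2" "d $ 2 = 2" "d $ 3 = 2"
    unfolding defs by (simp_all only: vector_3)
  have "a $ 1 \<noteq> b $ 1" "a $ 1 \<noteq> c $ 1" "a $ 1 \<noteq> d $ 1" "b $ 2 \<noteq> c $ 2" "b $ 2 \<noteq> d $ 2" "c $ 3 \<noteq> d $ 3"
    unfolding comps by simp_all
  then have ne: "a \<noteq> b" "a \<noteq> c" "a \<noteq> d" "b \<noteq> c" "b \<noteq> d" "c \<noteq> d"
    by metis+
  have lookup: "Poly_Mapping.lookup motzkin e =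
      (if e = a then 1 else if e = b then 1 else if e = c then 1 else if e = d then - 3 else 0)" for e
    using ne unfolding motzkin_def defs[symmetric]
    by (auto simp: lookup_add lookup_minus lookup_single when_def)
  have keys: "Poly_Mapping.keys motzkin = {a, b, c, d}"
    by (auto simp: in_keys_iff lookup split: if_splits)
  show ?thesis
    using ne ne[symmetric]
    unfolding eval_mpoly_def keys UNIV_3
    by (simp add: lookup comps vector_3)
qed

end

theory Submission
  imports Defs
begin

text \<open>
  Restrict to a line through \<open>(1, 1, 1)\<close> in a coordinate direction and divide by the one monomial
  \<open>x\<^sup>b\<close> that may have a negative coefficient: the sum of the values at \<open>x\<close> and \<open>1/x\<close> of a circuit that
  is nonnegative at \<open>(1, 1, 1)\<close> then grows at least like a multiple of \<open>(x - 1)\<^sup>2\<close>, unless the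
  exponents do not vary in this direction. But a summand of \<open>M\<^sup>m\<close> lies between \<open>0\<close> and \<open>M\<^sup>m\<close>, which
  vanishes to order \<open>2m\<close> at \<open>(1, 1, 1)\<close>. Hence for \<open>m \<ge> 2\<close> all summands are zero.
\<close>

section \<open>Evaluation of polynomials\<close>

text \<open>Padding the support with zero coefficients lets polynomials with different supports be
  evaluated over one common index set.\<close>

lemma eval_mpoly_superset:
  fixes f :: "'n::finite mpoly"
  assumes "finite A" "Poly_Mapping.keys f \<subseteq> A"
  shows "eval_mpoly f x =
    (\<Sum>\<alpha>\<in>A. Poly_Mapping.lookup f \<alpha> * (\<Prod>i\<in>UNIV. x $ i ^ (\<alpha> $ i)))"
  unfolding eval_mpoly_def using assms
  by (intro sum.mono_neutral_left) (auto simp: in_keys_iff)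

lemma eval_mpoly_zero [simp]: "eval_mpoly 0 x = 0"
  by (simp add: eval_mpoly_def)

lemma eval_mpoly_single:
  "eval_mpoly (Poly_Mapping.single \<alpha> c) x = c * (\<Prod>i\<in>UNIV. x $ i ^ (\<alpha> $ i))"
  by (subst eval_mpoly_superset[of "{\<alpha>}"]) auto

lemma eval_mpoly_add: "eval_mpoly (f + g) x = eval_mpoly f x + eval_mpoly g x"
proof -
  let ?A = "Poly_Mapping.keys f \<union> Poly_Mapping.keys g"
  have "Poly_Mapping.keys (f + g) \<subseteq> ?A"
    by (rule keys_add)
  then show ?thesis
    by (simp add: eval_mpoly_superset[of ?A] lookup_add distrib_right sum.distrib)
qed

lemma eval_mpoly_sum: "eval_mpoly (sum f A) x = (\<Sum>a\<in>A. eval_mpoly (f a) x)"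
  by (induction A rule: infinite_finite_induct) (simp_all add: eval_mpoly_add)

lemma eval_mpoly_sum_list: "eval_mpoly (sum_list fs) x = (\<Sum>f\<leftarrow>fs. eval_mpoly f x)"
  by (induction fs) (simp_all add: eval_mpoly_add)

lemma sum_single_lookup:
  "(\<Sum>a\<in>Poly_Mapping.keys f. Poly_Mapping.single a (Poly_Mapping.lookup f a)) = f"
  by (rule poly_mapping_eqI)
    (auto simp: lookup_sum lookup_single when_def in_keys_iff sum.delta')

lemma eval_mpoly_mult:
  fixes f g :: "'n::finite mpoly"
  shows "eval_mpoly (f * g) x = eval_mpoly f x * eval_mpoly g x"
proof -
  \<comment> \<open>Splitting both factors into monomials reduces the convolution product to
    \<open>mult_single\<close>.\<close>
  have "f * g = (\<Sum>a\<in>Poly_Mapping.keys f. \<Sum>b\<in>Poly_Mapping.keys g.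
      Poly_Mapping.single (a + b) (Poly_Mapping.lookup f a * Poly_Mapping.lookup g b))"
    unfolding mult_single[symmetric] sum_product[symmetric] sum_single_lookup ..
  then have "eval_mpoly (f * g) x = (\<Sum>a\<in>Poly_Mapping.keys f. \<Sum>b\<in>Poly_Mapping.keys g.
      Poly_Mapping.lookup f a * Poly_Mapping.lookup g b * (\<Prod>i\<in>UNIV. x $ i ^ ((a + b) $ i)))"
    by (simp only: eval_mpoly_sum eval_mpoly_single)
  then show ?thesis
    by (simp add: eval_mpoly_def sum_product power_add prod.distrib mult_ac)
qed

lemma eval_mpoly_power: "eval_mpoly (f ^ m) x = eval_mpoly f x ^ m"
proof (induction m)
  case 0
  show ?case
    using eval_mpoly_single[of 0 1 x] by simp
qed (simp add: eval_mpoly_mult)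

section \<open>Second-order growth of circuits\<close>

lemma add_inverse_mono:
  fixes u v :: real
  assumes "1 \<le> u" "u \<le> v"
  shows "u + 1 / u \<le> v + 1 / v"
proof -
  have "1 \<le> u * v"
    using assms mult_mono[of 1 u 1 v] by simp
  then have "0 \<le> (v - u) * (1 - 1 / (u * v))"
    using assms by (intro mult_nonneg_nonneg) auto
  also have "\<dots> = v + 1 / v - (u + 1 / u)"
    using assms by (simp add: field_simps)
  finally show ?thesis by simp
qed

text \<open>With k = |a - b| the right side is x^k + 1/x^k. Since t + 1/t increases for t \<ge> 1
  and x \<le> x^k, it is at least x + 1/x, which equals the left side; so the bound is uniform in
  the exponents.\<close>

lemma power_ratio_symmetric_ge:
  fixes x :: real
  assumes "1 < x" "a \<noteq> b"
  shows "2 + (x - 1)\<^sup>2 / x \<le> x ^ a / x ^ b + (1 / x) ^ a * x ^ b"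
proof -
  have *: "2 + (x - 1)\<^sup>2 / x \<le> x ^ d / x ^ c + x ^ c / x ^ d" if less: "c < d" for c d :: nat
  proof -
    obtain k where d: "d = c + Suc k"
      using less_imp_Suc_add[OF less] by (metis add_Suc_right)
    have "x \<le> x ^ Suc k"
      using assms by (intro self_le_power) auto
    then have "x + 1 / x \<le> x ^ Suc k + 1 / x ^ Suc k"
      using assms by (intro add_inverse_mono) auto
    moreover have "2 + (x - 1)\<^sup>2 / x = x + 1 / x"
      using assms by (simp add: field_simps power2_eq_square)
    moreover have "x ^ d / x ^ c + x ^ c / x ^ d = x ^ Suc k + 1 / x ^ Suc k"
      using assms by (simp add: d power_add)
    ultimately show ?thesis by simp
  qed
  have "(1 / x) ^ a * x ^ b = x ^ b / x ^ a"
    by (simp add: power_divide)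
  then show ?thesis
    using *[of a b] *[of b a] assms by (cases "a < b") (auto simp: add.commute)
qed

definition coordinate_line :: "'n::finite \<Rightarrow> real \<Rightarrow> real ^ 'n" where
  "coordinate_line i x = (\<chi> j. if j = i then x else 1)"

lemma eval_mpoly_coordinate_line:
  "eval_mpoly f (coordinate_line i x) =
    (\<Sum>\<alpha>\<in>Poly_Mapping.keys f. Poly_Mapping.lookup f \<alpha> * x ^ (\<alpha> $ i))"
proof -
  have "(\<Prod>j\<in>UNIV. coordinate_line i x $ j ^ (\<alpha> $ j)) = x ^ (\<alpha> $ i)" for \<alpha> :: "nat ^ 'a"
  proof -
    have "(\<Prod>j\<in>UNIV. coordinate_line i x $ j ^ (\<alpha> $ j))
        = (\<Prod>j\<in>UNIV. if j = i then x ^ (\<alpha> $ j) else 1)"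
      by (intro prod.cong) (auto simp: coordinate_line_def)
    then show ?thesis by simp
  qed
  then show ?thesis
    by (simp add: eval_mpoly_def)
qed

text \<open>Pairing x with 1/x turns each monomial, after division by the \<beta>-monomial, into a
  quantity \<open>r \<gamma>\<close> \<ge> 2, with equality if \<gamma> and \<beta> agree at i.
  Subtracting twice the value at the all-ones point leaves only nonnegative terms, of which the one
  for \<alpha> is kept.\<close>

lemma coordinate_line_symmetric_ge:
  fixes f :: "'n::finite mpoly"
  assumes inner: "inner_support f \<subseteq> {\<beta>}"
    and one: "0 \<le> eval_mpoly f (coordinate_line i 1)"
    and \<alpha>: "\<alpha> \<in> Poly_Mapping.keys f" "\<alpha> $ i \<noteq> \<beta> $ i" and x: "1 < x"
  shows "Poly_Mapping.lookup f \<alpha> * ((x - 1)\<^sup>2 / x) \<le>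
    eval_mpoly f (coordinate_line i x) / x ^ (\<beta> $ i)
      + eval_mpoly f (coordinate_line i (1 / x)) * x ^ (\<beta> $ i)"
proof -
  define c where "c = Poly_Mapping.lookup f"
  define r where "r \<gamma> = x ^ (\<gamma> $ i) / x ^ (\<beta> $ i) + (1 / x) ^ (\<gamma> $ i) * x ^ (\<beta> $ i)"
    for \<gamma> :: "nat ^ 'n"
  have pos: "0 < c \<gamma>" if "\<gamma> \<in> Poly_Mapping.keys f" "\<gamma> \<noteq> \<beta>" for \<gamma>
    using that inner by (auto simp: inner_support_def square_support_def c_def)
  have r_same: "r \<gamma> = 2" if "\<gamma> $ i = \<beta> $ i" for \<gamma>
    using x that by (simp add: r_def power_divide)
  have r_ge: "2 + (x - 1)\<^sup>2 / x \<le> r \<gamma>" if "\<gamma> $ i \<noteq> \<beta> $ i" for \<gamma>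
    using power_ratio_symmetric_ge[OF x that] by (simp add: r_def)
  have r_ge2: "2 \<le> r \<gamma>" for \<gamma>
  proof (cases "\<gamma> $ i = \<beta> $ i")
    case False
    have "0 \<le> (x - 1)\<^sup>2 / x"
      using x by simp
    with r_ge[OF False] show ?thesis by linarith
  qed (simp add: r_same)
  have "c \<alpha> * ((x - 1)\<^sup>2 / x) \<le> c \<alpha> * (r \<alpha> - 2)"
    using pos[OF \<alpha>(1)] r_ge[OF \<alpha>(2)] \<alpha>(2) by (intro mult_left_mono) fastforce+
  also have "\<dots> \<le> (\<Sum>\<gamma>\<in>Poly_Mapping.keys f. c \<gamma> * (r \<gamma> - 2))"
  proof (rule member_le_sum[OF \<alpha>(1)])
    fix \<gamma> assume "\<gamma> \<in> Poly_Mapping.keys f - {\<alpha>}"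
    then show "0 \<le> c \<gamma> * (r \<gamma> - 2)"
      \<comment> \<open>The coefficient at \<beta> may be negative, but there the factor
        \<open>r \<beta> - 2\<close> vanishes.\<close>
      using pos[of \<gamma>] r_ge2[of \<gamma>] r_same[of \<gamma>] by (cases "\<gamma> = \<beta>") auto
  qed simp
  also have "\<dots> = (\<Sum>\<gamma>\<in>Poly_Mapping.keys f. c \<gamma> * r \<gamma>) - 2 * (\<Sum>\<gamma>\<in>Poly_Mapping.keys f. c \<gamma>)"
    by (simp add: right_diff_distrib sum_subtractf sum_distrib_left mult_ac)
  also have "\<dots> \<le> (\<Sum>\<gamma>\<in>Poly_Mapping.keys f. c \<gamma> * r \<gamma>)"
    using one by (simp add: eval_mpoly_coordinate_line c_def)
  also have "\<dots> = eval_mpoly f (coordinate_line i x) / x ^ (\<beta> $ i)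
      + eval_mpoly f (coordinate_line i (1 / x)) * x ^ (\<beta> $ i)"
    by (simp add: eval_mpoly_coordinate_line r_def c_def sum_divide_distrib sum_distrib_right
        sum.distrib distrib_left mult.assoc)
  finally show ?thesis
    by (simp add: c_def)
qed

text \<open>An exponent other than \<beta> would have a positive coefficient and differ from \<beta>
  in some coordinate i, forcing quadratic growth along that line; the upper bound is of smaller
  order because \<open>q i\<close> tends to 0 at 1. What remains is a multiple of one monomial, and
  it vanishes at the all-ones point.\<close>

lemma mpoly_eq_zero_if_small_at_ones:
  fixes f :: "'n::finite mpoly"
  assumes inner: "inner_support f \<subseteq> {\<beta>}"
    and one: "eval_mpoly f (\<chi> j. 1) = 0"
    and cont: "\<And>i. isCont (q i) 1" and q1: "\<And>i. q i 1 = 0"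
    and le: "\<And>i x. 0 < x \<Longrightarrow> eval_mpoly f (coordinate_line i x) \<le> (x - 1)\<^sup>2 * q i x"
  shows "f = 0"
proof -
  have line1: "coordinate_line i 1 = (\<chi> j. 1)" for i :: 'n
    by (simp add: coordinate_line_def)
  have "\<alpha> = \<beta>" if \<alpha>: "\<alpha> \<in> Poly_Mapping.keys f" for \<alpha>
  proof (rule ccontr)
    assume "\<alpha> \<noteq> \<beta>"
    then obtain i where i: "\<alpha> $ i \<noteq> \<beta> $ i"
      by (auto simp: vec_eq_iff)
    define c where "c = Poly_Mapping.lookup f \<alpha>"
    define b where "b = \<beta> $ i"
    \<comment> \<open>The symmetrised upper bound divided by (x - 1)^2 / x, using (1/x - 1)^2 = (x -
      1)^2 / x^2.\<close>
    define G where "G x = x * (q i x / x ^ b) + q i (1 / x) * x ^ b / x" for x :: real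
    have "c \<le> G x" if x: "1 < x" for x
    proof -
      have "c * ((x - 1)\<^sup>2 / x) \<le> eval_mpoly f (coordinate_line i x) / x ^ b
          + eval_mpoly f (coordinate_line i (1 / x)) * x ^ b"
        unfolding c_def b_def
        by (rule coordinate_line_symmetric_ge[OF inner _ \<alpha> i x]) (simp add: line1 one)
      also have "\<dots> \<le> (x - 1)\<^sup>2 * q i x / x ^ b + (1 / x - 1)\<^sup>2 * q i (1 / x) * x ^ b"
        using x by (intro add_mono divide_right_mono mult_right_mono le) auto
      also have "\<dots> = G x * ((x - 1)\<^sup>2 / x)"
        using x by (simp add: G_def field_simps power2_eq_square)
      finally show ?thesis
        using x by (subst (asm) mult_le_cancel_right_pos) auto
    qed
    \<comment> \<open>Letting x tend to 1 from the right gives c \<le> \<open>G 1\<close>, which is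
      0.\<close>
    then have "eventually (\<lambda>x. c \<le> G x) (at_right 1)"
      by (rule eventually_mono[OF eventually_at_right_less])
    moreover have "isCont (\<lambda>x. q i (1 / x)) 1"
      by (rule isCont_o2[where g = "q i"]) (simp_all add: cont)
    then have "isCont G 1"
      unfolding G_def by (auto intro!: continuous_intros cont)
    then have "(G \<longlongrightarrow> G 1) (at_right 1)"
      by (simp add: isCont_def filterlim_at_split)
    ultimately have "c \<le> G 1"
      by (intro tendsto_lowerbound) auto
    moreover have "0 < c"
      using \<alpha> \<open>\<alpha> \<noteq> \<beta>\<close> inner by (auto simp: inner_support_def square_support_def c_def)
    ultimately show False
      by (simp add: G_def q1)
  qed
  then have "Poly_Mapping.keys f \<subseteq> {\<beta>}"
    by blast
  then have "Poly_Mapping.lookup f \<beta> = 0"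
    using one by (simp add: eval_mpoly_superset[of "{\<beta>}"])
  then have "\<beta> \<notin> Poly_Mapping.keys f"
    by (simp add: in_keys_iff)
  with \<open>Poly_Mapping.keys f \<subseteq> {\<beta>}\<close> have "Poly_Mapping.keys f = {}"
    by blast
  then show ?thesis by simp
qed

section \<open>The Motzkin form\<close>

lemma eval_motzkin':
  "eval_mpoly motzkin x = (x $ 1)^4 * (x $ 2)\<^sup>2 + (x $ 1)\<^sup>2 * (x $ 2)^4 + (x $ 3)^6
     - 3 * (x $ 1)\<^sup>2 * (x $ 2)\<^sup>2 * (x $ 3)\<^sup>2"
proof -
  have "x = vector [x $ 1, x $ 2, x $ 3]"
    by (simp add: vec_eq_iff forall_3)
  then show ?thesis
    using eval_motzkin by metis
qed

lemma motzkin_nonneg: "0 \<le> eval_mpoly motzkin x"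
proof -
  have "0 \<le> a^4 * b\<^sup>2 + a\<^sup>2 * b^4 + c^6 - 3 * a\<^sup>2 * b\<^sup>2 * c\<^sup>2" (is "0 \<le> ?M") for a b c :: real
  proof (cases "a = 0 \<or> b = 0")
    case False
    \<comment> \<open>The positive multiplier (a^2 + b^2)^2 makes the form a visible sum of
      nonnegative terms. If a or b is zero, only c^6 remains.\<close>
    have "?M * (a\<^sup>2 + b\<^sup>2)\<^sup>2
        = a\<^sup>2 * b\<^sup>2 * (a\<^sup>2 + b\<^sup>2 + c\<^sup>2) * (a\<^sup>2 + b\<^sup>2 - 2 * c\<^sup>2)\<^sup>2 + (a\<^sup>2 - b\<^sup>2)\<^sup>2 * (c^3)\<^sup>2"
      by algebra
    also have "\<dots> \<ge> 0"
      by simp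
    finally show ?thesis
      using False by (simp add: zero_le_mult_iff)
  qed auto
  then show ?thesis
    by (simp add: eval_motzkin')
qed

lemma motzkin_coordinate_line:
  obtains r where "isCont r 1"
    "\<And>x. eval_mpoly motzkin (coordinate_line i x) = (x - 1)\<^sup>2 * r x"
proof -
  consider "i = 1 \<or> i = 2" | "i = 3"
    using exhaust_3 by auto
  then show ?thesis
  proof cases
    \<comment> \<open>With the other variables 1, the form is x^4 - 2x^2 + 1 = (x^2 - 1)^2 here, and
      x^6 - 3x^2 + 2 = (x^2 - 1)^2 (x^2 + 2) in the third direction.\<close>
    case 1
    show ?thesis
    proof
      show "isCont (\<lambda>x::real. (x + 1)\<^sup>2) 1"
        by (intro continuous_intros)
      show "eval_mpoly motzkin (coordinate_line i x) = (x - 1)\<^sup>2 * (x + 1)\<^sup>2" for x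
        using 1 unfolding eval_motzkin' coordinate_line_def
        by (auto simp: power4_eq_xxxx power2_eq_square algebra_simps)
    qed
  next
    case 2
    show ?thesis
    proof
      show "isCont (\<lambda>x::real. (x + 1)\<^sup>2 * (x\<^sup>2 + 2)) 1"
        by (intro continuous_intros)
      show "eval_mpoly motzkin (coordinate_line i x) = (x - 1)\<^sup>2 * ((x + 1)\<^sup>2 * (x\<^sup>2 + 2))" for x
        using 2 unfolding eval_motzkin' coordinate_line_def
        by (simp add: power_numeral_reduce algebra_simps)
    qed
  qed
qed

section \<open>Exclusion of the higher powers\<close>

lemma motzkin_power_not_sonc: "motzkin ^ Suc (Suc n) \<notin> sonc_forms k"
proof
  assume "motzkin ^ Suc (Suc n) \<in> sonc_forms k"
  then obtain fs where fs: "motzkin ^ Suc (Suc n) = sum_list fs"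
    and circ: "\<And>f. f \<in> set fs \<Longrightarrow> nonneg_circuit f"
    by (auto simp: sonc_forms_def)
  obtain r where r: "\<And>i. isCont (r i) 1"
    "\<And>i x. eval_mpoly motzkin (coordinate_line i x) = (x - 1)\<^sup>2 * r i x"
  proof -
    have "\<forall>i. \<exists>r. isCont r 1 \<and>
        (\<forall>x. eval_mpoly motzkin (coordinate_line i x) = (x - 1)\<^sup>2 * r x)"
      by (meson motzkin_coordinate_line)
    from choice[OF this] that show ?thesis by blast
  qed
  \<comment> \<open>The power of the form on the line is (x - 1)^2 times \<open>q i x\<close>. The
    exponent \<open>Suc n\<close> is positive, so a factor (x - 1)^2 is left over and
    \<open>q i 1\<close> is 0.\<close>
  define q where "q i x = r i x * ((x - 1)\<^sup>2 * r i x) ^ Suc n" for i and x :: real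
  have nonneg: "0 \<le> eval_mpoly f x" if "f \<in> set fs" for f x
    using circ[OF that] by (simp add: nonneg_circuit_def)
  have le: "eval_mpoly f x \<le> eval_mpoly motzkin x ^ Suc (Suc n)" if "f \<in> set fs" for f x
  proof -
    have "eval_mpoly f x \<le> (\<Sum>f\<leftarrow>fs. eval_mpoly f x)"
      using that nonneg by (intro member_le_sum_list) auto
    then show ?thesis
      by (simp only: eval_mpoly_sum_list[symmetric] fs[symmetric] eval_mpoly_power)
  qed
  have "f = 0" if f: "f \<in> set fs" for f
  proof -
    \<comment> \<open>If the inner support is empty, any \<beta> serves.\<close>
    obtain \<beta> where "inner_support f \<subseteq> {\<beta>}"
      using circ[OF f] by (auto simp: nonneg_circuit_def circuit_def)
    then show ?thesis
    proof (rule mpoly_eq_zero_if_small_at_ones)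
      show "eval_mpoly f (\<chi> j. 1) = 0"
        using nonneg[OF f, of "\<chi> j. 1"] le[OF f, of "\<chi> j. 1"] by (simp add: eval_motzkin')
      show "isCont (q i) 1" for i
        unfolding q_def by (intro continuous_intros r)
      show "q i 1 = 0" for i
        by (simp add: q_def)
      show "eval_mpoly f (coordinate_line i x) \<le> (x - 1)\<^sup>2 * q i x" for i x
        using le[OF f, of "coordinate_line i x"] by (simp add: r q_def mult_ac)
    qed
  qed
  then have "motzkin ^ Suc (Suc n) = 0"
    unfolding fs by (induction fs) auto
  \<comment> \<open>At (0, 0, 1) the Motzkin form has the value 1.\<close>
  then have "eval_mpoly motzkin (axis 3 1) ^ Suc (Suc n) = 0"
    by (metis eval_mpoly_power eval_mpoly_zero)
  then show False
    by (simp add: eval_motzkin' axis_def)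
qed

section \<open>The Motzkin form as a nonnegative circuit\<close>

lemma motzkin_support:
  defines "a \<equiv> vector [4, 2, 0]" and "b \<equiv> vector [2, 4, 0]"
    and "c \<equiv> vector [0, 0, 6]" and "d \<equiv> vector [2, 2, 2]"
  shows "Poly_Mapping.keys motzkin = {a, b, c, d}"
    and "square_support motzkin = {a, b, c}"
    and "inner_support motzkin = {d}"
proof -
  note defs = a_def b_def c_def d_def
  have ne: "a \<noteq> b" "a \<noteq> c" "a \<noteq> d" "b \<noteq> c" "b \<noteq> d" "c \<noteq> d"
    unfolding defs by (simp_all add: vec_eq_iff forall_3)
  have lookup: "Poly_Mapping.lookup motzkin e =
      (if e = a then 1 else if e = b then 1 else if e = c then 1 else if e = d then - 3 else 0)" for e
    using ne unfolding motzkin_def defs[symmetric]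
    by (auto simp: lookup_add lookup_minus lookup_single when_def)
  show keys: "Poly_Mapping.keys motzkin = {a, b, c, d}"
    by (auto simp: in_keys_iff lookup split: if_splits)
  have even: "\<forall>i. even (a $ i)" "\<forall>i. even (b $ i)" "\<forall>i. even (c $ i)"
    unfolding defs by (simp_all add: forall_3)
  show square: "square_support motzkin = {a, b, c}"
    unfolding square_support_def keys using ne even by (auto simp: lookup)
  show "inner_support motzkin = {d}"
    unfolding inner_support_def keys square using ne by auto
qed

lemma motzkin_circuit: "circuit motzkin"
proof -
  define A B C D :: "real ^ 3" where "A = vector [4, 2, 0]" and "B = vector [2, 4, 0]"
    and "C = vector [0, 0, 6]" and "D = vector [2, 2, 2]"
  note defs = A_def B_def C_def D_def
  have ne: "A \<noteq> B" "A \<noteq> C" "B \<noteq> C"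
    unfolding defs by (simp_all add: vec_eq_iff forall_3)
  have re: "real_exponent (vector [4, 2, 0]) = A" "real_exponent (vector [2, 4, 0]) = B"
    "real_exponent (vector [0, 0, 6]) = C" "real_exponent (vector [2, 2, 2]) = D"
    unfolding defs real_exponent_def by (simp_all add: vec_eq_iff forall_3)
  \<comment> \<open>The inner exponent is the centroid of the triangle; its equal positive weights
    witness membership both in the hull and in the relative interior.\<close>
  have D: "D = (1/3) *\<^sub>R A + (1/3) *\<^sub>R B + (1/3) *\<^sub>R C"
    unfolding defs by (simp add: vec_eq_iff forall_3)
  have indep: "\<not> affine_dependent {A, B, C}"
  proof
    assume "affine_dependent {A, B, C}"
    then obtain u where u: "sum u {A, B, C} = 0" "\<exists>v\<in>{A, B, C}. u v \<noteq> 0"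
      "(\<Sum>v\<in>{A, B, C}. u v *\<^sub>R v) = 0"
      by (subst (asm) affine_dependent_explicit_finite) auto
    then have "u A *\<^sub>R A + u B *\<^sub>R B + u C *\<^sub>R C = 0"
      using ne by (simp add: add.assoc)
    \<comment> \<open>The coordinates read 4 u(A) + 2 u(B) = 0, 2 u(A) + 4 u(B) = 0 and 6 u(C) =
      0.\<close>
    then have "u A = 0 \<and> u B = 0 \<and> u C = 0"
      unfolding vec_eq_iff forall_3 defs by (simp add: vector_3)
    with u(2) show False by auto
  qed
  have D_hull: "D \<in> convex hull {A, B, C}"
    unfolding convex_hull_3 D by (intro CollectI exI[of _ "1/3"]) auto
  have poly: "newton_polytope motzkin = convex hull {A, B, C}"
  proof -
    have "newton_polytope motzkin = convex hull (insert D {A, B, C})"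
      unfolding newton_polytope_def motzkin_support by (simp add: re insert_commute)
    then show ?thesis
      using D_hull by (simp only: hull_redundant)
  qed
  have vertices: "newton_vertices motzkin = {A, B, C}"
    unfolding newton_vertices_def poly
    using extreme_point_of_convex_hull_affine_independent[OF indep] by blast
  have "D \<in> rel_interior (convex hull {A, B, C})"
    unfolding rel_interior_convex_hull_explicit[OF indep]
    using ne by (intro CollectI exI[of _ "\<lambda>_. 1/3"]) (simp add: D add.assoc)
  then show ?thesis
    unfolding circuit_def vertices poly motzkin_support
    by (simp add: re indep)
qed

lemma motzkin_sonc: "motzkin \<in> sonc_forms 6"
proof -
  have "motzkin \<in> forms 6"
    by (simp add: forms_def motzkin_support(1) sum_3)
  moreover have "nonneg_circuit motzkin"
    by (simp add: nonneg_circuit_def motzkin_circuit motzkin_nonneg)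
  ultimately show ?thesis
    unfolding sonc_forms_def by (intro CollectI exI[of _ "[motzkin]"]) simp
qed

theorem proposition3p4:
  fixes m :: nat
  assumes "m \<ge> 1"
  shows "motzkin ^ m \<in> sonc_forms (6 * m) \<longleftrightarrow> m = 1"
proof (cases "m = 1")
  case True
  then show ?thesis
    by (simp add: motzkin_sonc)
next
  case False
  with assms obtain n where "m = Suc (Suc n)"
    by (cases m; cases "m - 1") auto
  with False show ?thesis
    by (simp only: motzkin_power_not_sonc simp_thms)
qed

end
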